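(* Let $n\ge1$ and consider an all-to-all cluster of $2n$ oscillators in the 2-group configuration with phases $\theta_+$ (oscillators $1,\dots,n$) and $\theta_-$ (oscillators $n+1,\dots,2n$), where $\|\theta_+-\theta_-\|\in[0,\pi]$ denotes the geodesic distance on the circle. The eigenvalues of its stability matrix $\mathcal J$ are $\lambda_1=0$, $\lambda_2=-2n\cos(\|\theta_+-\theta_-\|)$, and $\lambda_m=-n[\cos(\|\theta_+-\theta_-\|)+1]$ for $3\le m\le 2n$. The corresponding eigenvectors are $$\bm u_1=(2n)^{-1/2}(1,\dots,1),\qquad \bm u_2=(2n)^{-1/2}(\underbrace{1,\dots,1}_{n},\underbrace{-1,\dots,-1}_{n}),$$ and, for $m\ge3$, the $2n-2$ vectors $2^{-1/2}(0,\dots,0,1,-1,0,\dots,0)$ with the entries $1,-1$ at positions $(x,x+1)$, where $x\in\{1,\dots,n-1,n+1,\dots,2n-1\}$. Moreover, the cluster in the 2-group configuration is linearly stable if and only if $\|\theta_+-\theta_-\|<\pi/2$.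
   Context: Model: $N$ (even) oscillators with phases $\theta_i\in\mathbb S^1$ evolve by $\dot\theta_i=\omega_i-\frac1N\sum_{j=1}^N a_{ij}\sin(\theta_i-\theta_j)$, where $a_{ij}=1$ if $\|\theta_i-\theta_j\|\le\Delta$ and $0$ otherwise, $\|\cdot\|$ being geodesic distance on $\mathbb S^1$ and $\Delta\in[0,\pi]$. The natural frequencies are $\omega_i=\omega_0\ge 0$ for $i\in\bm I_+$ and $\omega_i=-\omega_0$ for $i\in\bm I_-$. A cluster is a connected component of the graph with adjacency matrix $(a_{ij})$; it contains $n$ oscillators from $\bm I_+$ and $n$ from $\bm I_-$. It is all-to-all if $a_{ij}=1$ for all $i,j$ in it, and in the 2-group configuration if its oscillators in $\bm I_+$ all have phase $\theta_+$ and its oscillators in $\bm I_-$ all have phase $\theta_-$. The stability matrix of a cluster is the $2n\times2n$ matrix (indices running over the cluster) $\mathcal J_{ij}=a_{ij}\cos(\theta_i-\theta_j)$ for $i\ne j$ and $\mathcal J_{ii}=-\sum_{k\ne i}a_{ik}\cos(\theta_i-\theta_k)$. It always has the eigenvalue $0$ with eigenvector $(1,\dots,1)$. The cluster is called linearly stable if all the other $2n-1$ eigenvalues (with multiplicity) are strictly negative. *)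

theory Defs
  imports
    "HOL-Library.Real_Mod"
    "HOL-Library.Multiset"
    "Jordan_Normal_Form.Char_Poly"
    "Jordan_Normal_Form.VS_Connect"
begin

text \<open>Points of the circle are represented by real angles modulo \<^term>\<open>2 * pi\<close>.\<close>

definition geodesic_dist :: "real \<Rightarrow> real \<Rightarrow> real" where
  "geodesic_dist x y = (INF k::int. \<bar>x - y - 2 * pi * of_int k\<bar>)"

definition adj :: "real \<Rightarrow> (nat \<Rightarrow> real) \<Rightarrow> nat \<Rightarrow> nat \<Rightarrow> real" where
  "adj \<Delta> \<theta> i j = (if geodesic_dist (\<theta> i) (\<theta> j) \<le> \<Delta> then 1 else 0)"

text \<open>The oscillators are \<^term>\<open>{..<N}\<close>; \<open>Iplus\<close> and \<open>Iminus\<close> are the sets of those with natural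
  frequency \<open>\<omega>0\<close> and \<open>- \<omega>0\<close>.\<close>

locale oscillators =
  fixes N :: nat and \<omega>0 :: real and Iplus Iminus :: "nat set" and \<Delta> :: real
  assumes even_N: "even N"
    and omega0_nonneg: "0 \<le> \<omega>0"
    and groups_cover: "Iplus \<union> Iminus = {..<N}"
    and groups_disjoint: "Iplus \<inter> Iminus = {}"
    and Delta_range: "0 \<le> \<Delta>" "\<Delta> \<le> pi"
begin

definition nat_freq :: "nat \<Rightarrow> real" where
  "nat_freq i = (if i \<in> Iplus then \<omega>0 else - \<omega>0)"

definition velocity :: "(nat \<Rightarrow> real) \<Rightarrow> nat \<Rightarrow> real" where
  "velocity \<theta> i = nat_freq i - 1 / real N * (\<Sum>j<N. adj \<Delta> \<theta> i j * sin (\<theta> i - \<theta> j))"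

end

definition interaction_graph :: "nat \<Rightarrow> real \<Rightarrow> (nat \<Rightarrow> real) \<Rightarrow> (nat \<times> nat) set" where
  "interaction_graph N \<Delta> \<theta> = {(i, j). i < N \<and> j < N \<and> adj \<Delta> \<theta> i j = 1}"

text \<open>The edge relation is symmetric, so its reflexive transitive closure is an equivalence
  relation whose classes are the connected components.\<close>

definition is_cluster ::
  "nat \<Rightarrow> nat set \<Rightarrow> nat set \<Rightarrow> real \<Rightarrow> (nat \<Rightarrow> real) \<Rightarrow> nat \<Rightarrow> nat set \<Rightarrow> bool" where
  "is_cluster N Iplus Iminus \<Delta> \<theta> n C \<longleftrightarrow>
     C \<in> {..<N} // (interaction_graph N \<Delta> \<theta>)\<^sup>* \<and> card (C \<inter> Iplus) = n \<and> card (C \<inter> Iminus) = n"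

definition all_to_all :: "real \<Rightarrow> (nat \<Rightarrow> real) \<Rightarrow> nat set \<Rightarrow> bool" where
  "all_to_all \<Delta> \<theta> C \<longleftrightarrow> (\<forall>i\<in>C. \<forall>j\<in>C. adj \<Delta> \<theta> i j = 1)"

definition two_group ::
  "nat set \<Rightarrow> nat set \<Rightarrow> (nat \<Rightarrow> real) \<Rightarrow> nat set \<Rightarrow> real \<Rightarrow> real \<Rightarrow> bool" where
  "two_group Iplus Iminus \<theta> C \<theta>p \<theta>m \<longleftrightarrow>
     (\<forall>i \<in> C \<inter> Iplus. [\<theta> i = \<theta>p] (rmod (2 * pi))) \<and>
     (\<forall>i \<in> C \<inter> Iminus. [\<theta> i = \<theta>m] (rmod (2 * pi)))"

text \<open>The list \<open>xs\<close> enumerates the oscillators of the cluster without repetition; the rows and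
  columns of the matrix are numbered, from 0, by the positions in \<open>xs\<close>. The matrix is \<open>N\<close> times the
  restriction to the cluster of the Jacobian of the velocity field with the adjacencies frozen.\<close>

definition stability_matrix :: "real \<Rightarrow> (nat \<Rightarrow> real) \<Rightarrow> nat list \<Rightarrow> real mat" where
  "stability_matrix \<Delta> \<theta> xs = mat (length xs) (length xs) (\<lambda>(i, j).
     if i \<noteq> j then adj \<Delta> \<theta> (xs ! i) (xs ! j) * cos (\<theta> (xs ! i) - \<theta> (xs ! j))
     else - (\<Sum>k \<in> {..<length xs} - {i}.
               adj \<Delta> \<theta> (xs ! i) (xs ! k) * cos (\<theta> (xs ! i) - \<theta> (xs ! k))))"

text \<open>Real eigenvalues with algebraic multiplicity. Stability matrices are symmetric, hence have no
  others.\<close>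

definition eigenvalue_mset :: "real mat \<Rightarrow> real multiset" where
  "eigenvalue_mset A = proots (char_poly A)"

text \<open>Only one copy of the eigenvalue 0 is discarded.\<close>

definition linearly_stable :: "real \<Rightarrow> (nat \<Rightarrow> real) \<Rightarrow> nat list \<Rightarrow> bool" where
  "linearly_stable \<Delta> \<theta> xs \<longleftrightarrow>
     (\<forall>\<mu> \<in># eigenvalue_mset (stability_matrix \<Delta> \<theta> xs) - {#0#}. \<mu> < 0)"

definition u1 :: "nat \<Rightarrow> real vec" where
  "u1 n = vec (2 * n) (\<lambda>i. 1 / sqrt (2 * real n))"

definition u2 :: "nat \<Rightarrow> real vec" where
  "u2 n = vec (2 * n) (\<lambda>i. if i < n then 1 / sqrt (2 * real n) else - 1 / sqrt (2 * real n))"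

text \<open>The parameter \<open>x\<close> counts positions from 1, whereas vector entries are numbered from 0.\<close>

definition u_diff :: "nat \<Rightarrow> nat \<Rightarrow> real vec" where
  "u_diff n x = vec (2 * n) (\<lambda>i. if i + 1 = x then 1 / sqrt 2
                                  else if i + 1 = x + 1 then - 1 / sqrt 2 else 0)"

end

theory Submission
  imports Defs "Jordan_Normal_Form.DL_Rank"
begin

text \<open>Angles enter only through cosines, and \<open>cos (\<theta>p - \<theta>m) = cos d\<close>. With \<open>c = cos d\<close> the stability
  matrix is therefore \<open>W - n (1 + c) I\<close>, where \<open>W\<close> has rank at most two: it acts on a vector only
  through the sums of the entries over the two groups. The three families of eigenvectors can be
  read off. They are independent because a relation between them says that the coefficients of the
  difference vectors increase by a constant step along each group, starting and ending at 0, so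
  that every step is 0. An eigenbasis diagonalises the matrix, which gives the spectrum with
  algebraic multiplicities.\<close>

section \<open>Geodesic distance on the circle\<close>

text \<open>The minimising \<open>k\<close> is the integer nearest to
  \<open>(x - y) / (2 * pi)\<close>; the rounding error of at most 1/2 becomes a distance of at most
  \<open>pi\<close>.\<close>

lemma geodesic_dist_attained:
  obtains k :: int where "geodesic_dist x y = \<bar>x - y - 2 * pi * of_int k\<bar>"
    and "geodesic_dist x y \<le> pi"
proof -
  define z where "z = (x - y) / (2 * pi)"
  have scale: "\<bar>x - y - 2 * pi * of_int k\<bar> = 2 * pi * \<bar>z - of_int k\<bar>" for k :: int
  proof -
    have "x - y - 2 * pi * of_int k = 2 * pi * (z - of_int k)"
      by (simp add: z_def field_simps)
    then show ?thesis
      by (simp add: abs_mult)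
  qed
  have eq: "geodesic_dist x y = \<bar>x - y - 2 * pi * of_int (round z)\<bar>"
    unfolding geodesic_dist_def
  proof (rule cInf_eq_minimum)
    fix t
    assume "t \<in> range (\<lambda>k::int. \<bar>x - y - 2 * pi * of_int k\<bar>)"
    then show "\<bar>x - y - 2 * pi * of_int (round z)\<bar> \<le> t"
      by (auto simp: scale round_diff_minimal)
  qed blast
  have "\<bar>z - of_int (round z)\<bar> \<le> 1 / 2"
    using of_int_round_abs_le[of z] by (simp add: abs_minus_commute)
  then have "2 * pi * \<bar>z - of_int (round z)\<bar> \<le> 2 * pi * (1 / 2)"
    by (intro mult_left_mono) auto
  then have "geodesic_dist x y \<le> pi"
    by (simp add: eq scale)
  with eq show thesis
    by (rule that)
qed

lemma geodesic_dist_nonneg: "0 \<le> geodesic_dist x y"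
  by (rule geodesic_dist_attained[of x y]) simp

lemma cos_geodesic_dist: "cos (geodesic_dist x y) = cos (x - y)"
proof -
  obtain k :: int where k: "geodesic_dist x y = \<bar>x - y - 2 * pi * of_int k\<bar>"
    by (rule geodesic_dist_attained)
  have "[x - y - 2 * pi * of_int k = x - y] (rmod (2 * pi))"
    unfolding rcong_altdef by (rule exI[of _ k]) simp
  from cos_rcong[OF this] show ?thesis
    by (simp add: k)
qed

text \<open>The distance lies between 0 and \<open>pi\<close>, where cosine is strictly decreasing.
  This turns the sign of an eigenvalue into a bound on the distance.\<close>

lemma cos_geodesic_dist_pos_iff: "0 < cos (geodesic_dist x y) \<longleftrightarrow> geodesic_dist x y < pi / 2"
proof -
  have "geodesic_dist x y \<le> pi"
    by (rule geodesic_dist_attained)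
  then have "cos (pi / 2) < cos (geodesic_dist x y) \<longleftrightarrow> geodesic_dist x y < pi / 2"
    by (intro cos_mono_less_eq geodesic_dist_nonneg) auto
  then show ?thesis
    by simp
qed

section \<open>Diagonalisation by an eigenbasis\<close>

text \<open>The eigenvector equations say \<open>A * P = P * D\<close> with \<open>D\<close>
  diagonal, so \<open>A\<close> and \<open>D\<close> are similar and share their characteristic
  polynomial. Algebraic multiplicities thus come without counting dimensions of eigenspaces.\<close>

lemma proots_char_poly_eigenbasis:
  fixes A :: "'a :: field mat"
  assumes A: "A \<in> carrier_mat n n" and P: "P \<in> carrier_mat n n" and "det P \<noteq> 0"
    and eig: "\<And>j. j < n \<Longrightarrow> A *\<^sub>v col P j = l j \<cdot>\<^sub>v col P j"
  shows "proots (char_poly A) = image_mset l (mset_set {..<n})"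
proof -
  define D where "D = mat n n (\<lambda>(i, j). if i = j then l j else 0)"
  have D: "D \<in> carrier_mat n n"
    by (simp add: D_def)
  obtain Q where Q: "Q \<in> carrier_mat n n" and inv: "P * Q = 1\<^sub>m n" "Q * P = 1\<^sub>m n"
    using det_non_zero_imp_unit[OF P \<open>det P \<noteq> 0\<close>, of "()"]
    unfolding Units_def ring_mat_def by auto
  have "A * P = P * D"
  proof (rule eq_matI)
    fix i j
    assume "i < dim_row (P * D)" "j < dim_col (P * D)"
    then have i: "i < n" and j: "j < n"
      using P D by auto
    have "(A * P) $$ (i, j) = (A *\<^sub>v col P j) $ i"
      using i j A P by simp
    also have "\<dots> = P $$ (i, j) * l j"
      using i j P by (simp add: eig)
    also have "\<dots> = (\<Sum>k = 0..<n. if k = j then P $$ (i, k) * l k else 0)"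
      using j by simp
    also have "\<dots> = (\<Sum>k = 0..<n. P $$ (i, k) * D $$ (k, j))"
      using j by (intro sum.cong) (auto simp: D_def)
    also have "\<dots> = (P * D) $$ (i, j)"
      using i j P D by (simp add: scalar_prod_def)
    finally show "(A * P) $$ (i, j) = (P * D) $$ (i, j)" .
  qed (use A P D in auto)
  moreover have "A = A * P * Q"
    using A P Q inv by (simp add: assoc_mult_mat[of _ n n _ n _ n])
  ultimately have "A = P * D * Q"
    by simp
  then have "similar_mat A D"
    using A D P Q inv by (intro similar_matI[of A D P Q n]) auto
  then have "char_poly A = char_poly D"
    by (rule char_poly_similar)
  also have "\<dots> = (\<Prod>a\<leftarrow>diag_mat D. [:- a, 1:])"
    using D by (rule char_poly_upper_triangular) (auto simp: D_def)
  also have "diag_mat D = map l [0..<n]"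
    by (simp add: diag_mat_def D_def)
  also have "(\<Prod>a\<leftarrow>map l [0..<n]. [:- a, 1:]) = (\<Prod>j<n. [:- l j, 1:])"
    by (simp add: prod.distinct_set_conv_list[symmetric] lessThan_atLeast0 comp_def)
  finally have "proots (char_poly A) = (\<Sum>j<n. {#l j#})"
    by (simp add: proots_prod)
  also have "(\<Sum>j<n. {#l j#}) = image_mset l (mset_set {..<n})"
    by (induction n) (simp_all add: lessThan_Suc)
  finally show ?thesis .
qed

text \<open>A nonzero determinant makes the columns independent and pairwise distinct; distinctness
  ensures that their set really has \<open>n\<close> elements, the dimension.\<close>

lemma (in vec_space) basis_cols_if_det_nonzero:
  assumes P: "P \<in> carrier_mat n n" and "det P \<noteq> 0"
  shows "basis (set (cols P))"
proof -
  have "distinct (cols P)"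
    using det_identical_cols[OF P] P \<open>det P \<noteq> 0\<close> by (force simp: distinct_conv_nth)
  moreover have "lin_indpt (set (cols P))"
    using lin_dep_cols_imp_det_0[OF P] \<open>det P \<noteq> 0\<close> by blast
  moreover have "set (cols P) \<subseteq> carrier_vec n"
    using cols_dim[of P] P by simp
  ultimately show ?thesis
    using P by (intro dim_li_is_basis) (auto simp: distinct_card dim_is_n)
qed

section \<open>The stability matrix of a 2-group cluster\<close>

text \<open>The first term puts 1 on the diagonal as well. The other entries of a row add up to
  \<open>n - 1 + n * c\<close>, so subtracting \<open>n * (1 + c)\<close> leaves exactly minus that
  sum on the diagonal.\<close>

definition two_group_matrix :: "nat \<Rightarrow> real \<Rightarrow> real mat" where
  "two_group_matrix n c = mat (2 * n) (2 * n) (\<lambda>(i, j).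
     (if (i < n) = (j < n) then 1 else c) - (if i = j then real n * (1 + c) else 0))"

lemma two_group_matrix_carrier [simp]: "two_group_matrix n c \<in> carrier_mat (2 * n) (2 * n)"
  by (simp add: two_group_matrix_def)

lemma sum_two_groups:
  fixes f :: "nat \<Rightarrow> 'a :: comm_monoid_add"
  shows "(\<Sum>j<2 * n. f j) = (\<Sum>j<n. f j) + (\<Sum>j = n..<2 * n. f j)"
  by (simp add: lessThan_atLeast0 sum.atLeastLessThan_concat)

lemma two_group_matrix_mult_vec:
  assumes v: "v \<in> carrier_vec (2 * n)" and i: "i < 2 * n"
  shows "(two_group_matrix n c *\<^sub>v v) $ i =
    (if i < n then (\<Sum>j<n. v $ j) + c * (\<Sum>j = n..<2 * n. v $ j)
     else c * (\<Sum>j<n. v $ j) + (\<Sum>j = n..<2 * n. v $ j)) - real n * (1 + c) * v $ i"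
proof -
  have "(two_group_matrix n c *\<^sub>v v) $ i =
      (\<Sum>j<2 * n. (if (i < n) = (j < n) then 1 else c) * v $ j
         - (if i = j then real n * (1 + c) * v $ j else 0))"
    using v i unfolding two_group_matrix_def
    by (auto simp: scalar_prod_def lessThan_atLeast0 left_diff_distrib intro!: sum.cong)
  also have "\<dots> = (\<Sum>j<2 * n. (if (i < n) = (j < n) then 1 else c) * v $ j)
      - real n * (1 + c) * v $ i"
    using i by (simp add: sum_subtractf)
  also have "(\<Sum>j<2 * n. (if (i < n) = (j < n) then 1 else c) * v $ j) =
      (\<Sum>j<n. (if i < n then 1 else c) * v $ j)
      + (\<Sum>j = n..<2 * n. (if i < n then c else 1) * v $ j)"
    unfolding sum_two_groups by (intro arg_cong2[where f = "(+)"] sum.cong) auto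
  finally show ?thesis
    by (auto simp: sum_distrib_left)
qed

text \<open>Phases are fixed only modulo \<open>2 * pi\<close>, which cosine does not see; evenness
  of cosine gives both cross blocks the same entry.\<close>

lemma stability_matrix_two_group:
  assumes "length ps = n" "length ms = n"
    and all: "all_to_all \<Delta> \<theta> (set (ps @ ms))"
    and ps: "\<forall>i\<in>set ps. [\<theta> i = \<theta>p] (rmod (2 * pi))"
    and ms: "\<forall>i\<in>set ms. [\<theta> i = \<theta>m] (rmod (2 * pi))"
  shows "stability_matrix \<Delta> \<theta> (ps @ ms) = two_group_matrix n (cos (geodesic_dist \<theta>p \<theta>m))"
proof -
  define c where "c = cos (geodesic_dist \<theta>p \<theta>m)"
  define xs where "xs = ps @ ms"
  have len: "length xs = 2 * n"
    using assms by (simp add: xs_def)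
  have phase: "[\<theta> (xs ! i) = (if i < n then \<theta>p else \<theta>m)] (rmod (2 * pi))" if "i < 2 * n" for i
    using that assms(1,2) ps ms by (auto simp: xs_def nth_append)
  have entry: "adj \<Delta> \<theta> (xs ! i) (xs ! j) * cos (\<theta> (xs ! i) - \<theta> (xs ! j)) =
      (if (i < n) = (j < n) then 1 else c)" if "i < 2 * n" "j < 2 * n" for i j
  proof -
    have "adj \<Delta> \<theta> (xs ! i) (xs ! j) = 1"
      using all that unfolding all_to_all_def xs_def[symmetric] by (simp add: len)
    moreover have "cos (\<theta> (xs ! i) - \<theta> (xs ! j)) =
        cos ((if i < n then \<theta>p else \<theta>m) - (if j < n then \<theta>p else \<theta>m))"
      by (intro cos_rcong rcong_diff phase that)
    moreover have "cos (\<theta>p - \<theta>m) = c" "cos (\<theta>m - \<theta>p) = c"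
      unfolding c_def cos_geodesic_dist by (simp_all add: cos_diff mult.commute)
    ultimately show ?thesis
      by auto
  qed
  have off_diag: "(\<Sum>k\<in>{..<2 * n} - {i}. if (i < n) = (k < n) then 1 else c) =
      real n * (1 + c) - 1" if "i < 2 * n" for i
  proof -
    have "(\<Sum>k<2 * n. if (i < n) = (k < n) then 1 else c) =
        (\<Sum>k<n. if i < n then 1 else c) + (\<Sum>k = n..<2 * n. if i < n then c else 1)"
      unfolding sum_two_groups by (intro arg_cong2[where f = "(+)"] sum.cong) auto
    also have "\<dots> = real n * (1 + c)"
      by (simp add: algebra_simps)
    finally show ?thesis
      using that by (simp add: sum_diff1)
  qed
  have "stability_matrix \<Delta> \<theta> xs = two_group_matrix n c"
  proof (rule eq_matI)
    fix i j
    assume "i < dim_row (two_group_matrix n c)" "j < dim_col (two_group_matrix n c)"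
    then have i: "i < 2 * n" and j: "j < 2 * n"
      by (simp_all add: two_group_matrix_def)
    have "(\<Sum>k\<in>{..<2 * n} - {i}.
        adj \<Delta> \<theta> (xs ! i) (xs ! k) * cos (\<theta> (xs ! i) - \<theta> (xs ! k))) = real n * (1 + c) - 1"
      unfolding off_diag[OF i, symmetric] by (intro sum.cong refl entry i) simp
    then show "stability_matrix \<Delta> \<theta> xs $$ (i, j) = two_group_matrix n c $$ (i, j)"
      using i j entry[OF i j] by (auto simp: stability_matrix_def two_group_matrix_def len)
  qed (simp_all add: stability_matrix_def two_group_matrix_def len)
  then show ?thesis
    by (simp add: xs_def c_def)
qed

section \<open>Eigenvectors and their independence\<close>

text \<open>Position \<open>x\<close> of the difference vectors ranges over the indices other than 0 and \<open>n\<close>, so these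
  two free slots house \<open>u1\<close> and \<open>u2\<close>.\<close>

definition eigvec :: "nat \<Rightarrow> nat \<Rightarrow> real vec" where
  "eigvec n j = (if j = 0 then u1 n else if j = n then u2 n else u_diff n j)"

definition eigval :: "nat \<Rightarrow> real \<Rightarrow> nat \<Rightarrow> real" where
  "eigval n c j = (if j = 0 then 0 else if j = n then - 2 * real n * c else - real n * (c + 1))"

lemma dim_eigvec [simp]: "dim_vec (eigvec n j) = 2 * n"
  by (simp add: eigvec_def u1_def u2_def u_diff_def)

lemma eigvec_carrier [simp]: "eigvec n j \<in> carrier_vec (2 * n)"
  by (rule carrier_vecI) (rule dim_eigvec)

definition eigvec_matrix :: "nat \<Rightarrow> real mat" where
  "eigvec_matrix n = mat (2 * n) (2 * n) (\<lambda>(i, j). eigvec n j $ i)"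

lemma eigvec_matrix_carrier [simp]: "eigvec_matrix n \<in> carrier_mat (2 * n) (2 * n)"
  by (simp add: eigvec_matrix_def)

lemma col_eigvec_matrix: "j < 2 * n \<Longrightarrow> col (eigvec_matrix n) j = eigvec n j"
  by (intro eq_vecI) (auto simp: eigvec_matrix_def)

text \<open>Only the two group sums matter: they are equal for \<open>u1\<close>, opposite for
  \<open>u2\<close>, and both 0 for a difference vector, which leaves the scalar part
  \<open>- n * (1 + c)\<close>.\<close>

lemma two_group_matrix_eigvec:
  assumes "j < 2 * n"
  shows "two_group_matrix n c *\<^sub>v eigvec n j = eigval n c j \<cdot>\<^sub>v eigvec n j"
proof (rule eq_vecI)
  fix i
  assume "i < dim_vec (eigval n c j \<cdot>\<^sub>v eigvec n j)"
  then have i: "i < 2 * n"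
    by simp
  consider "j = 0" | "j = n" "j \<noteq> 0" | "j \<noteq> 0" "j \<noteq> n"
    by blast
  then show "(two_group_matrix n c *\<^sub>v eigvec n j) $ i = (eigval n c j \<cdot>\<^sub>v eigvec n j) $ i"
  proof cases
    case 1
    then show ?thesis
      using i by (simp add: two_group_matrix_mult_vec eigvec_def eigval_def u1_def algebra_simps add_divide_distrib)
  next
    case 2
    then have "(\<Sum>k<n. u2 n $ k) = real n / sqrt (2 * real n)"
      and "(\<Sum>k = n..<2 * n. u2 n $ k) = - real n / sqrt (2 * real n)"
      by (simp_all add: u2_def)
    then show ?thesis
      using 2 i eigvec_carrier[of n j]
      by (simp add: two_group_matrix_mult_vec eigvec_def eigval_def) (simp add: u2_def algebra_simps add_divide_distrib)
  next
    case 3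
    \<comment> \<open>As \<open>j\<close> is neither 0 nor \<open>n\<close>, the positions
      \<open>j - 1\<close> and \<open>j\<close> lie in the same group: the two terms cancel in its
      sum and are absent from the other.\<close>
    have entry: "u_diff n j $ k =
        (if k = j - 1 then 1 / sqrt 2 else 0) + (if k = j then - 1 / sqrt 2 else 0)"
      if "k < 2 * n" for k
      using that 3 by (auto simp: u_diff_def)
    have "(\<Sum>k<n. u_diff n j $ k) =
        (\<Sum>k<n. (if k = j - 1 then 1 / sqrt 2 else 0) + (if k = j then - 1 / sqrt 2 else 0))"
      by (intro sum.cong refl entry) simp
    also have "\<dots> = 0"
      using 3 assms by (auto simp: sum.distrib)
    finally have fst: "(\<Sum>k<n. u_diff n j $ k) = 0" .
    have "(\<Sum>k = n..<2 * n. u_diff n j $ k) =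
        (\<Sum>k = n..<2 * n. (if k = j - 1 then 1 / sqrt 2 else 0)
          + (if k = j then - 1 / sqrt 2 else 0))"
      by (intro sum.cong refl entry) simp
    also have "\<dots> = 0"
      using 3 assms by (auto simp: sum.distrib)
    finally have snd: "(\<Sum>k = n..<2 * n. u_diff n j $ k) = 0" .
    show ?thesis
      using 3 i fst snd eigvec_carrier[of n j]
      by (simp add: two_group_matrix_mult_vec eigvec_def eigval_def algebra_simps)
  qed
qed (simp add: two_group_matrix_def)

lemma det_eigvec_nonzero:
  assumes n: "n \<ge> 1"
  shows "det (eigvec_matrix n) \<noteq> 0"
proof
  assume "det (eigvec_matrix n) = 0"
  then obtain v where v: "v \<in> carrier_vec (2 * n)" "v \<noteq> 0\<^sub>v (2 * n)"
    and ker: "eigvec_matrix n *\<^sub>v v = 0\<^sub>v (2 * n)"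
    using det_0_iff_vec_prod_zero_field[OF eigvec_matrix_carrier] by blast
  define r where "r = 1 / sqrt (2 * real n)"
  define s where "s = 1 / sqrt (2 :: real)"
  \<comment> \<open>\<open>w\<close> keeps the coefficients of the difference vectors and is 0 in
    the slots of \<open>u1\<close> and \<open>u2\<close> and past the end. These zeros are the
    boundary values, and they give all rows one form, even at the ends of the groups.\<close>
  define w where "w x = (if x = 0 \<or> x = n \<or> x \<ge> 2 * n then 0 else v $ x)" for x
  have w0: "w 0 = 0" "w n = 0" "w (2 * n) = 0"
    by (simp_all add: w_def)
  have nz: "r \<noteq> 0" "s \<noteq> 0"
    using n by (auto simp: r_def s_def)
  \<comment> \<open>Position \<open>i\<close> carries the positive entry of
    \<open>u_diff n (i + 1)\<close> and the negative entry of \<open>u_diff n i\<close>, hence the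
    forward difference of \<open>w\<close>.\<close>
  have row: "r * v $ 0 + (if i < n then r else - r) * v $ n + s * (w (i + 1) - w i) = 0"
    if i: "i < 2 * n" for i
  proof -
    have "0 = (\<Sum>j<2 * n. eigvec n j $ i * v $ j)"
      using arg_cong[OF ker, of "\<lambda>x. x $ i"] i v(1)
      by (simp add: scalar_prod_def eigvec_matrix_def lessThan_atLeast0)
    also have "\<dots> = (\<Sum>j<2 * n. (if j = 0 then r * v $ 0 else 0)
        + (if j = n then (if i < n then r else - r) * v $ n else 0)
        + (if j = i + 1 then s * w (i + 1) else 0) - (if j = i then s * w i else 0))"
      using i n
      by (intro sum.cong)
        (auto simp: eigvec_def u1_def u2_def u_diff_def r_def s_def w_def)
    also have "\<dots> = r * v $ 0 + (if i < n then r else - r) * v $ n + s * w (i + 1) - s * w i"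
      using i n by (auto simp: sum.distrib sum_subtractf w_def)
    finally show ?thesis
      by (simp add: algebra_simps)
  qed
  \<comment> \<open>Solving a row for \<open>w (i + 1)\<close> gives a constant decrement:
    \<open>K\<close> in the first group, and \<open>L\<close> in the second, where the entries of
    \<open>u2\<close> change sign.\<close>
  define K where "K = r * (v $ 0 + v $ n) / s"
  define L where "L = r * (v $ 0 - v $ n) / s"
  have stepK: "w (Suc i) = w i - K" if "i < n" for i
    using row[of i] that nz by (simp add: K_def field_simps)
  have stepL: "w (Suc (i + n)) = w (i + n) - L" if "i < n" for i
    using row[of "i + n"] that nz by (simp add: L_def field_simps)
  have wK: "w i = - real i * K" if "i \<le> n" for i
    using that by (induction i) (auto simp: w0 stepK algebra_simps)
  have wL: "w (i + n) = - real i * L" if "i \<le> n" for i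
    using that by (induction i) (auto simp: w0 stepL algebra_simps)
  \<comment> \<open>The boundary values \<open>w n = 0\<close> and \<open>w (2 * n) = 0\<close>
    force \<open>n * K = 0\<close> and \<open>n * L = 0\<close>.\<close>
  have "K = 0" "L = 0"
    using wK[of n] wL[of n] w0 n by (auto simp: mult_2)
  then have "v $ 0 + v $ n = 0" "v $ 0 - v $ n = 0"
    using nz by (auto simp: K_def L_def)
  then have ends: "v $ 0 = 0" "v $ n = 0"
    by auto
  have "w i = 0" if "i < 2 * n" for i
    using wK[of i] wL[of "i - n"] that \<open>K = 0\<close> \<open>L = 0\<close> by (cases "i \<le> n") auto
  then have "v $ i = 0" if "i < 2 * n" for i
    using that ends unfolding w_def by (metis not_le)
  then have "v = 0\<^sub>v (2 * n)"
    using v(1) by (intro eq_vecI) auto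
  with v(2) show False ..
qed

section \<open>Spectrum, eigenbasis and stability of the cluster\<close>

theorem mainTheorem2:
  fixes N n :: nat and \<omega>0 \<Delta> \<theta>p \<theta>m :: real and \<theta> :: "nat \<Rightarrow> real"
    and Iplus Iminus C :: "nat set" and ps ms :: "nat list"
  defines "d \<equiv> geodesic_dist \<theta>p \<theta>m"
    and "J \<equiv> stability_matrix \<Delta> \<theta> (ps @ ms)"
    and "X \<equiv> {1..n - 1} \<union> {n + 1..2 * n - 1}"
  assumes model: "oscillators N \<omega>0 Iplus Iminus \<Delta>"
    and n: "n \<ge> 1"
    and cluster: "is_cluster N Iplus Iminus \<Delta> \<theta> n C"
    and complete: "all_to_all \<Delta> \<theta> C"
    and config: "two_group Iplus Iminus \<theta> C \<theta>p \<theta>m"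
    and plus_labels: "distinct ps" "set ps = C \<inter> Iplus"
    and minus_labels: "distinct ms" "set ms = C \<inter> Iminus"
  shows "eigenvalue_mset J =
           {#0, - 2 * real n * cos d#} + replicate_mset (2 * n - 2) (- real n * (cos d + 1))
       \<and> eigenvector J (u1 n) 0
       \<and> eigenvector J (u2 n) (- 2 * real n * cos d)
       \<and> (\<forall>x\<in>X. eigenvector J (u_diff n x) (- real n * (cos d + 1)))
       \<and> card X = 2 * n - 2
       \<and> vectorspace.basis class_ring (module_vec TYPE(real) (2 * n))
            ({u1 n, u2 n} \<union> u_diff n ` X)
       \<and> (linearly_stable \<Delta> \<theta> (ps @ ms) \<longleftrightarrow> d < pi / 2)"
proof -
  define c where "c = cos d"
  define P where "P = eigvec_matrix n"
  have P: "P \<in> carrier_mat (2 * n) (2 * n)"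
    by (simp add: P_def)
  have det: "det P \<noteq> 0"
    unfolding P_def using n by (rule det_eigvec_nonzero)
  have col: "col P j = eigvec n j" if "j < 2 * n" for j
    using that by (simp add: P_def col_eigvec_matrix)
  interpret oscillators N \<omega>0 Iplus Iminus \<Delta>
    by (rule model)
  let ?G = "interaction_graph N \<Delta> \<theta>"
  \<comment> \<open>Makes the two groups exhaust \<open>C\<close>. The closure is reflexive on all
    naturals, but a path starting below \<open>N\<close> stays there.\<close>
  have "C \<subseteq> {..<N}"
  proof -
    obtain x where x: "x < N" "C = ?G\<^sup>* `` {x}"
      using cluster by (auto simp: is_cluster_def quotient_def)
    have "y < N" if "(x, y) \<in> ?G\<^sup>*" for y
      using that x(1) by (induction) (auto simp: interaction_graph_def)
    with x(2) show ?thesis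
      by auto
  qed
  then have C: "set (ps @ ms) = C"
    using groups_cover plus_labels minus_labels by auto
  have len: "length ps = n" "length ms = n"
    using cluster plus_labels minus_labels
    by (auto simp: is_cluster_def distinct_card[symmetric])
  have J: "J = two_group_matrix n c"
    unfolding J_def c_def d_def
    using complete config C plus_labels(2) minus_labels(2)
    by (intro stability_matrix_two_group len) (auto simp: two_group_def)
  have dim: "dim_row J = 2 * n"
    by (simp add: J two_group_matrix_def)
  have cardX: "card X = 2 * n - 2"
    unfolding X_def by (subst card_Un_disjoint) auto
  have indices: "{..<2 * n} = insert 0 (insert n X)" and X: "0 \<notin> X" "n \<notin> X" "finite X"
    using n by (auto simp: X_def)
  have eig: "J *\<^sub>v col P j = eigval n c j \<cdot>\<^sub>v col P j" if "j < 2 * n" for j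
    using that by (simp add: J col two_group_matrix_eigvec)
  have spectrum: "eigenvalue_mset J =
      {#0, - 2 * real n * c#} + replicate_mset (2 * n - 2) (- real n * (c + 1))"
  proof -
    have "eigenvalue_mset J = image_mset (eigval n c) (mset_set {..<2 * n})"
      unfolding eigenvalue_mset_def
      by (rule proots_char_poly_eigenbasis[OF _ P det eig]) (simp_all add: J)
    also have "\<dots> = {#0, - 2 * real n * c#} + image_mset (eigval n c) (mset_set X)"
      using X n by (simp add: indices eigval_def)
    also have "image_mset (eigval n c) (mset_set X) =
        image_mset (\<lambda>_. - real n * (c + 1)) (mset_set X)"
      using X by (intro image_mset_cong) (auto simp: eigval_def)
    finally show ?thesis
      by (simp add: image_mset_const_eq cardX)
  qed
  have ev: "eigenvector J (eigvec n j) (eigval n c j)" if "j < 2 * n" for j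
  proof -
    have "eigvec n j \<noteq> 0\<^sub>v (2 * n)"
    proof
      assume "eigvec n j = 0\<^sub>v (2 * n)"
      \<comment> \<open>This entry is positive in every case: truncated subtraction selects entry 0
        of \<open>u1\<close>, \<open>n - 1\<close> is in the first group for \<open>u2\<close>, and
        a difference vector has its positive entry there.\<close>
      then have "eigvec n j $ (j - 1) = 0"
        using that by simp
      then show False
        using n that by (auto simp: eigvec_def u1_def u2_def u_diff_def split: if_splits)
    qed
    then show ?thesis
      using eig[OF that] that by (simp add: eigenvector_def dim col)
  qed
  have diff: "\<forall>x\<in>X. eigenvector J (u_diff n x) (- real n * (c + 1))"
  proof
    fix x
    assume "x \<in> X"
    then have "x < 2 * n" "x \<noteq> 0" "x \<noteq> n"
      using X by (auto simp: X_def)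
    then show "eigenvector J (u_diff n x) (- real n * (c + 1))"
      using ev[of x] by (simp add: eigvec_def eigval_def)
  qed
  interpret vec_space "TYPE(real)" "2 * n" .
  have "set (cols P) = eigvec n ` {..<2 * n}"
    using P col by (auto simp: cols_def lessThan_atLeast0)
  also have "\<dots> = {u1 n, u2 n} \<union> u_diff n ` X"
  proof -
    have "eigvec n ` X = u_diff n ` X"
      using X by (intro image_cong) (auto simp: eigvec_def)
    moreover have "eigvec n 0 = u1 n" "eigvec n n = u2 n"
      using n by (simp_all add: eigvec_def)
    ultimately show ?thesis
      by (simp add: indices)
  qed
  finally have basis: "basis ({u1 n, u2 n} \<union> u_diff n ` X)"
    using basis_cols_if_det_nonzero[OF P det] by simp
  \<comment> \<open>Discarding one 0 leaves \<open>- 2 * n * c\<close>, which is negative only if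
    \<open>c > 0\<close>; then \<open>- n * (c + 1)\<close> is negative too. For
    \<open>c = 0\<close> a second 0 survives.\<close>
  have "linearly_stable \<Delta> \<theta> (ps @ ms) \<longleftrightarrow> 0 < c"
    unfolding linearly_stable_def J_def[symmetric] spectrum
    using n by (auto simp: zero_less_mult_iff add_pos_pos)
  then have stable: "linearly_stable \<Delta> \<theta> (ps @ ms) \<longleftrightarrow> d < pi / 2"
    by (simp add: c_def d_def cos_geodesic_dist_pos_iff)
  show ?thesis
    using spectrum ev[of 0] ev[of n] diff cardX basis stable n
    by (simp add: eigvec_def eigval_def c_def)
qed

end
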